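(* Let $(X,d)$ be a pseudometric space with integer-valued pseudometric, let $\mathcal{S}_X$ be the set of all splits of $X$ and let $\mathcal{S}$ be the set of all $d$-splits. Let $\lambda_S\in(-\infty,\alpha^d_S]$ for every $S\in\mathcal{S}$ and $\lambda_S=0$ for every $S\in\mathcal{S}_X\setminus\mathcal{S}$. Then $$\widetilde d:=d-\sum_{S\in\mathcal{S}}\lambda_S\delta_S$$ is a pseudometric such that for every split $S\in\mathcal{S}_X$ one has $$\alpha^{\widetilde d}_S=\alpha^d_S-\lambda_S.$$ In particular, there is a split-prime pseudometric $d_0$ such that $$d=d_0+\sum_{S\in\mathcal{S}_X}\alpha^d_S\delta_S.$$
   Context: A split of a set $X$ is an unordered pair $S=\{A,B\}$ of non-empty subsets with $X=A\sqcup B$; for $x\in X$, $S(x)$ is the element of $S$ containing $x$, and $\delta_S(x,y)=1$ if $S(x)\ne S(y)$, $\delta_S(x,y)=0$ otherwise. For a pseudometric $d$ on $X$, the isolation index of a pair $S=\{A,B\}$ of non-empty subsets is $$\alpha^d_S=\tfrac12\inf_{a,a'\in A,\;b,b'\in B}\bigl[\max\{d(a,b)+d(a',b'),\,d(a',b)+d(a,b'),\,d(a,a')+d(b,b')\}-d(a,a')-d(b,b')\bigr].$$ A split $S$ is a $d$-split if $\alpha^d_S>0$. A pseudometric $d_0$ on $X$ is split-prime if $\alpha^{d_0}_S=0$ for every split $S$ of $X$. For an integer-valued pseudometric $d$, any two points are separated by only finitely many $d$-splits, so the sums above are pointwise finite. *)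

theory Defs
  imports "HOL-Analysis.Infinite_Sum"
begin

definition pseudometric_on :: "'a set \<Rightarrow> ('a \<Rightarrow> 'a \<Rightarrow> real) \<Rightarrow> bool" where
  "pseudometric_on X d \<longleftrightarrow>
     (\<forall>x\<in>X. \<forall>y\<in>X. 0 \<le> d x y) \<and>
     (\<forall>x\<in>X. d x x = 0) \<and>
     (\<forall>x\<in>X. \<forall>y\<in>X. d x y = d y x) \<and>
     (\<forall>x\<in>X. \<forall>y\<in>X. \<forall>z\<in>X. d x z \<le> d x y + d y z)"

definition splits :: "'a set \<Rightarrow> 'a set set set" where
  "splits X = {{A, B} | A B. A \<noteq> {} \<and> B \<noteq> {} \<and> A \<inter> B = {} \<and> A \<union> B = X}"

definition split_part :: "'a set set \<Rightarrow> 'a \<Rightarrow> 'a set" where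
  "split_part S x = (THE C. C \<in> S \<and> x \<in> C)"

definition split_delta :: "'a set set \<Rightarrow> 'a \<Rightarrow> 'a \<Rightarrow> real" where
  "split_delta S x y = (if split_part S x \<noteq> split_part S y then 1 else 0)"

(* The pair S = {A, B} is unordered, so both ways of naming its members contribute; they give
   the same set of values, see isolation_index_pair. All values are nonnegative, so the infimum
   is that of a nonempty set of reals bounded below. *)
definition isolation_index :: "('a \<Rightarrow> 'a \<Rightarrow> real) \<Rightarrow> 'a set set \<Rightarrow> real" where
  "isolation_index d S = 1 / 2 * Inf
     {Max {d a b + d a' b', d a' b + d a b', d a a' + d b b'} - d a a' - d b b' | A B a a' b b'.
        S = {A, B} \<and> a \<in> A \<and> a' \<in> A \<and> b \<in> B \<and> b' \<in> B}"

definition d_splits :: "'a set \<Rightarrow> ('a \<Rightarrow> 'a \<Rightarrow> real) \<Rightarrow> 'a set set set" where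
  "d_splits X d = {S \<in> splits X. isolation_index d S > 0}"

definition split_prime :: "'a set \<Rightarrow> ('a \<Rightarrow> 'a \<Rightarrow> real) \<Rightarrow> bool" where
  "split_prime X d \<longleftrightarrow> (\<forall>S\<in>splits X. isolation_index d S = 0)"

lemma isolation_index_pair:
  assumes sym: "\<And>x y. x \<in> A \<union> B \<Longrightarrow> y \<in> A \<union> B \<Longrightarrow> d x y = d y x"
  shows "isolation_index d {A, B} = 1 / 2 * Inf
     {Max {d a b + d a' b', d a' b + d a b', d a a' + d b b'} - d a a' - d b b' | a a' b b'.
        a \<in> A \<and> a' \<in> A \<and> b \<in> B \<and> b' \<in> B}"
proof -
  define F where "F a a' b b' =
    Max {d a b + d a' b', d a' b + d a b', d a a' + d b b'} - d a a' - d b b'" for a a' b b'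
  have F_swap: "F b b' a a' = F a a' b b'" if "a \<in> A" "a' \<in> A" "b \<in> B" "b' \<in> B" for a a' b b'
  proof -
    have "d b a = d a b" "d b' a' = d a' b'" "d b' a = d a b'" "d b a' = d a' b"
      by (rule sym; use that in simp)+
    then show ?thesis by (simp add: F_def add.commute)
  qed
  have "{F a a' b b' | A' B' a a' b b'.
          {A, B} = {A', B'} \<and> a \<in> A' \<and> a' \<in> A' \<and> b \<in> B' \<and> b' \<in> B'}
      = {F a a' b b' | a a' b b'. a \<in> A \<and> a' \<in> A \<and> b \<in> B \<and> b' \<in> B}" (is "?L = ?R")
  proof (rule equalityI; rule subsetI)
    fix r assume "r \<in> ?L"
    then obtain A' B' a a' b b' where r: "r = F a a' b b'" and e: "{A, B} = {A', B'}"
      and m: "a \<in> A'" "a' \<in> A'" "b \<in> B'" "b' \<in> B'" by (elim CollectE exE conjE)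
    from e have "A' = A \<and> B' = B \<or> A' = B \<and> B' = A" by (auto simp: doubleton_eq_iff)
    then show "r \<in> ?R"
    proof
      assume "A' = A \<and> B' = B" then show ?thesis using r m by blast
    next
      assume *: "A' = B \<and> B' = A"
      then have "r = F b b' a a'" using r m F_swap[of b b' a a'] by simp
      then show ?thesis using m * by blast
    qed
  next
    fix r assume "r \<in> ?R" then show "r \<in> ?L" by blast
  qed
  then show ?thesis by (simp only: isolation_index_def F_def)
qed

end

theory Submission
  imports Defs
begin

text \<open>Subtracting \<open>\<lambda> \<delta>\<^sub>T\<close> for a single \<open>d\<close>-split \<open>T\<close> preserves every isolation index other than that of \<open>T\<close>,
  together with the quadruples attaining it. By positivity of the isolation index of \<open>T\<close>, the only
  quadruples of \<open>S\<close> that could be affected are those also separated by \<open>T\<close> in the same way; there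
  a fifth point, on which \<open>S\<close> and \<open>T\<close> disagree, shows that the isolation indices of \<open>S\<close> and \<open>T\<close> add up.
  Integrality makes the infima minima and the indices of \<open>d\<close>-splits at least \<open>1/2\<close>, so that removing
  finitely many \<open>d\<close>-splits completely bounds the number of them separating \<open>x\<close> and \<open>y\<close> by \<open>2 d(x,y)\<close>.
  The infinite sum thus agrees with a finite one on any four points, on which the finite case
  applies.\<close>

text \<open>Twice the isolation index is the infimum of these numbers. The value is zero exactly
  when \<open>d a a' + d b b'\<close> is a largest one of the three pair sums. Nested binary maxima
  unfold to linear case distinctions.\<close>

definition gap :: "('a \<Rightarrow> 'a \<Rightarrow> real) \<Rightarrow> 'a \<Rightarrow> 'a \<Rightarrow> 'a \<Rightarrow> 'a \<Rightarrow> real" where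
  "gap d a a' b b' =
     max (max (d a b + d a' b') (d a' b + d a b')) (d a a' + d b b') - d a a' - d b b'"

text \<open>Speaking of sides through \<open>split_part\<close> avoids naming the two parts, so the
  order of the unordered pair never matters.\<close>

definition separates :: "'a set set \<Rightarrow> 'a \<Rightarrow> 'a \<Rightarrow> 'a \<Rightarrow> 'a \<Rightarrow> bool" where
  "separates S a a' b b' \<longleftrightarrow>
     split_part S a = split_part S a' \<and> split_part S b = split_part S b' \<and>
     split_part S a \<noteq> split_part S b"

text \<open>For a split \<open>S\<close> this means that \<open>v\<close> is at most the isolation
  index, expressed without an infimum; in this form the bound passes through each
  subtraction.\<close>

definition isolated_by :: "'a set \<Rightarrow> ('a \<Rightarrow> 'a \<Rightarrow> real) \<Rightarrow> 'a set set \<Rightarrow> real \<Rightarrow> bool" where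
  "isolated_by X d S v \<longleftrightarrow>
     (\<forall>a\<in>X. \<forall>a'\<in>X. \<forall>b\<in>X. \<forall>b'\<in>X. separates S a a' b b' \<longrightarrow> 2 * v \<le> gap d a a' b b')"

lemma isolated_byD:
  "isolated_by X d S v \<Longrightarrow> a \<in> X \<Longrightarrow> a' \<in> X \<Longrightarrow> b \<in> X \<Longrightarrow> b' \<in> X \<Longrightarrow>
    separates S a a' b b' \<Longrightarrow> 2 * v \<le> gap d a a' b b'"
  by (auto simp: isolated_by_def)

lemma gap_cong:
  assumes "\<And>x y. x \<in> {a, a', b, b'} \<Longrightarrow> y \<in> {a, a', b, b'} \<Longrightarrow> d x y = e x y"
  shows "gap d a a' b b' = gap e a a' b b'"
  using assms by (simp add: gap_def)

lemma gap_nonneg: "0 \<le> gap d a a' b b'"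
  by (simp add: gap_def)

text \<open>The third pair sum contributes zero to the gap and cannot reach a positive
  \<open>u\<close>, so a disjunction of two linear inequalities remains.\<close>

lemma gap_pos_iff:
  assumes "0 < u"
  shows "u \<le> gap d a a' b b' \<longleftrightarrow>
    d a a' + d b b' + u \<le> d a b + d a' b' \<or> d a a' + d b b' + u \<le> d a' b + d a b'"
  using assms by (auto simp: gap_def max_def)

lemma pseudometric_onD:
  assumes "pseudometric_on X d"
  shows "x \<in> X \<Longrightarrow> y \<in> X \<Longrightarrow> 0 \<le> d x y"
    and "x \<in> X \<Longrightarrow> d x x = 0"
    and "x \<in> X \<Longrightarrow> y \<in> X \<Longrightarrow> d x y = d y x"
    and "x \<in> X \<Longrightarrow> y \<in> X \<Longrightarrow> z \<in> X \<Longrightarrow> d x z \<le> d x y + d y z"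
  using assms unfolding pseudometric_on_def by blast+

section \<open>Splits as equivalence relations with two classes\<close>

lemma splitsE:
  assumes "S \<in> splits X"
  obtains A B where "S = {A, B}" "A \<noteq> {}" "B \<noteq> {}" "A \<inter> B = {}" "A \<union> B = X"
  using assms unfolding splits_def by blast

lemma split_part_eqI:
  assumes "S \<in> splits X" "C \<in> S" "x \<in> C"
  shows "split_part S x = C"
proof -
  obtain A B where S: "S = {A, B}" "A \<inter> B = {}" using assms(1) by (elim splitsE)
  show ?thesis unfolding split_part_def by (rule the_equality) (use S assms(2,3) in auto)
qed

lemma split_part_mem:
  assumes "S \<in> splits X" "x \<in> X"
  shows "split_part S x \<in> S" "x \<in> split_part S x"
proof -
  obtain C where "C \<in> S" "x \<in> C" using assms by (elim splitsE) blast
  then show "split_part S x \<in> S" "x \<in> split_part S x"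
    using split_part_eqI[OF assms(1)] by auto
qed

lemma split_part_two:
  assumes "S \<in> splits X" "x \<in> X" "y \<in> X" "z \<in> X" "split_part S x \<noteq> split_part S y"
  shows "split_part S z = split_part S x \<or> split_part S z = split_part S y"
proof -
  obtain A B where S: "S = {A, B}" using assms(1) by (elim splitsE)
  show ?thesis
    using split_part_mem(1)[OF assms(1,2)] split_part_mem(1)[OF assms(1,3)]
      split_part_mem(1)[OF assms(1,4)] assms(5) unfolding S by auto
qed

lemma split_part_eq_fibre:
  assumes "S \<in> splits X" "x \<in> X"
  shows "split_part S x = {y \<in> X. split_part S y = split_part S x}"
proof (intro equalityI subsetI)
  fix y assume y: "y \<in> split_part S x"
  have m: "split_part S x \<in> S" by (rule split_part_mem(1)[OF assms])
  have "y \<in> X" using m y assms(1) by (elim splitsE) auto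
  then show "y \<in> {y \<in> X. split_part S y = split_part S x}"
    using split_part_eqI[OF assms(1) m y] by simp
next
  fix y assume "y \<in> {y \<in> X. split_part S y = split_part S x}"
  then show "y \<in> split_part S x" using split_part_mem(2)[OF assms(1), of y] by auto
qed

lemma split_eq_image:
  assumes "S \<in> splits X"
  shows "S = split_part S ` X"
proof (intro equalityI subsetI)
  fix C assume C: "C \<in> S"
  then obtain x where x: "x \<in> C" using assms by (elim splitsE) blast
  have "x \<in> X" using assms C x by (elim splitsE) auto
  then show "C \<in> split_part S ` X" using split_part_eqI[OF assms C x] by blast
qed (use split_part_mem(1)[OF assms] in auto)

lemma split_eqI:
  assumes "S \<in> splits X" "T \<in> splits X"
    and "\<And>x y. x \<in> X \<Longrightarrow> y \<in> X \<Longrightarrow>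
      split_part S x = split_part S y \<longleftrightarrow> split_part T x = split_part T y"
  shows "S = T"
proof -
  have "split_part S x = split_part T x" if "x \<in> X" for x
  proof -
    have "{y \<in> X. split_part S y = split_part S x} = {y \<in> X. split_part T y = split_part T x}"
      using assms(3)[OF _ that] by blast
    then show ?thesis
      using split_part_eq_fibre[OF assms(1) that] split_part_eq_fibre[OF assms(2) that] by simp
  qed
  then have "split_part S ` X = split_part T ` X" by (rule image_cong[OF refl])
  then show ?thesis using split_eq_image[OF assms(1)] split_eq_image[OF assms(2)] by simp
qed

lemma separates_exists:
  assumes "S \<in> splits X"
  obtains a b where "a \<in> X" "b \<in> X" "separates S a a b b"
proof -
  obtain A B where "S = {A, B}" "A \<noteq> {}" "B \<noteq> {}" "A \<inter> B = {}" "A \<union> B = X"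
    using assms by (elim splitsE)
  moreover from this obtain a b where "a \<in> A" "b \<in> B" by blast
  ultimately have S: "S = {A, B}" "a \<in> A" "b \<in> B" "A \<inter> B = {}" "A \<union> B = X" by simp_all
  then have "split_part S a = A" "split_part S b = B" "A \<noteq> B"
    using split_part_eqI[OF assms] by auto
  then show thesis using that[of a b] S by (auto simp: separates_def)
qed

section \<open>The isolation index as an infimum of gaps\<close>

definition gaps :: "'a set \<Rightarrow> ('a \<Rightarrow> 'a \<Rightarrow> real) \<Rightarrow> 'a set set \<Rightarrow> real set" where
  "gaps X d S = {gap d a a' b b' | a a' b b'.
     a \<in> X \<and> a' \<in> X \<and> b \<in> X \<and> b' \<in> X \<and> separates S a a' b b'}"

lemma gapsE:
  assumes "z \<in> gaps X d S"
  obtains a a' b b' where "a \<in> X" "a' \<in> X" "b \<in> X" "b' \<in> X" "separates S a a' b b'"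
    "z = gap d a a' b b'"
  using assms unfolding gaps_def by (elim CollectE exE conjE)

lemma gapsI:
  "a \<in> X \<Longrightarrow> a' \<in> X \<Longrightarrow> b \<in> X \<Longrightarrow> b' \<in> X \<Longrightarrow> separates S a a' b b' \<Longrightarrow>
    gap d a a' b b' \<in> gaps X d S"
  unfolding gaps_def by blast

lemma gaps_nonneg: "z \<in> gaps X d S \<Longrightarrow> 0 \<le> z"
  using gap_nonneg by (elim gapsE) simp

lemma gaps_nonempty: "S \<in> splits X \<Longrightarrow> gaps X d S \<noteq> {}"
  using separates_exists[of S X] gapsI[of _ X] by (metis empty_iff)

lemma isolated_by_iff_gaps: "isolated_by X d S v \<longleftrightarrow> (\<forall>z\<in>gaps X d S. 2 * v \<le> z)"
proof
  assume "isolated_by X d S v"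
  then show "\<forall>z\<in>gaps X d S. 2 * v \<le> z" by (auto elim!: gapsE dest: isolated_byD)
next
  assume "\<forall>z\<in>gaps X d S. 2 * v \<le> z"
  then show "isolated_by X d S v" unfolding isolated_by_def by (simp add: gapsI)
qed

lemma isolation_index_gap:
  assumes "S \<in> splits X"
  shows "isolation_index d S = 1 / 2 * Inf (gaps X d S)"
proof -
  have max: "Max {d a b + d a' b', d a' b + d a b', d a a' + d b b'} - d a a' - d b b'
      = gap d a a' b b'" for a a' b b'
    by (simp add: gap_def max.assoc)
  have iff: "(\<exists>A B. S = {A, B} \<and> a \<in> A \<and> a' \<in> A \<and> b \<in> B \<and> b' \<in> B) \<longleftrightarrow>
      a \<in> X \<and> a' \<in> X \<and> b \<in> X \<and> b' \<in> X \<and> separates S a a' b b'" (is "?L \<longleftrightarrow> ?R") for a a' b b'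
  proof
    assume ?L
    then obtain A B where S: "S = {A, B}" "a \<in> A" "a' \<in> A" "b \<in> B" "b' \<in> B" by blast
    obtain A' B' where S': "S = {A', B'}" "A' \<noteq> {}" "A' \<inter> B' = {}" "A' \<union> B' = X"
      using assms by (elim splitsE)
    \<comment> \<open>\<open>A = B\<close> would force \<open>A' = B'\<close>, which is impossible
      for disjoint parts with \<open>A'\<close> non-empty.\<close>
    have "A \<noteq> B" "A \<subseteq> X" "B \<subseteq> X" using S(1) S' by (auto simp: doubleton_eq_iff)
    moreover have "split_part S a = A" "split_part S a' = A" "split_part S b = B" "split_part S b' = B"
      using S split_part_eqI[OF assms] by auto
    ultimately show ?R using S by (auto simp: separates_def)
  next
    assume R: ?R
    obtain A B where S: "S = {A, B}" using assms by (elim splitsE)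
    have "split_part S a \<in> {A, B}" "split_part S b \<in> {A, B}" "split_part S a \<noteq> split_part S b"
      using R split_part_mem(1)[OF assms] S by (auto simp: separates_def)
    then have "S = {split_part S a, split_part S b}" using S by auto
    moreover have "split_part S a = split_part S a'" "split_part S b = split_part S b'"
      using R by (auto simp: separates_def)
    moreover have "a \<in> split_part S a" "a' \<in> split_part S a'" "b \<in> split_part S b"
      "b' \<in> split_part S b'"
      using R split_part_mem(2)[OF assms] by simp_all
    ultimately show ?L by metis
  qed
  have "{gap d a a' b b' | A B a a' b b'. S = {A, B} \<and> a \<in> A \<and> a' \<in> A \<and> b \<in> B \<and> b' \<in> B}
      = gaps X d S"
    unfolding gaps_def iff[symmetric] by (intro Collect_cong) iprover
  then show ?thesis unfolding isolation_index_def max by simp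
qed

lemma isolation_index_eqI:
  assumes "S \<in> splits X" "isolated_by X d S v"
    and "a \<in> X" "a' \<in> X" "b \<in> X" "b' \<in> X" "separates S a a' b b'" "gap d a a' b b' = 2 * v"
  shows "isolation_index d S = v"
proof -
  have "Inf (gaps X d S) = 2 * v"
    using gapsI[OF assms(3-7), of d] assms(2,8)
    by (intro cInf_eq_minimum) (simp_all add: isolated_by_iff_gaps)
  then show ?thesis using isolation_index_gap[OF assms(1), of d] by simp
qed

lemma isolated_by_isolation_index:
  assumes "S \<in> splits X"
  shows "isolated_by X d S (isolation_index d S)"
proof -
  have "bdd_below (gaps X d S)" by (rule bdd_belowI[of _ 0]) (rule gaps_nonneg)
  then show ?thesis
    unfolding isolated_by_iff_gaps isolation_index_gap[OF assms, of d]
    by (simp add: cInf_lower)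
qed

lemma isolation_index_nonneg:
  assumes "S \<in> splits X"
  shows "0 \<le> isolation_index d S"
  unfolding isolation_index_gap[OF assms, of d]
  using cInf_greatest[OF gaps_nonempty[OF assms] gaps_nonneg] by simp

text \<open>Under integrality the gaps are nonnegative integers, so the infimum is a minimum. The
  attaining quadruple later turns a lower bound into an equality; integrality of its gap makes
  positive indices at least 1/2.\<close>

lemma isolation_index_attained:
  assumes S: "S \<in> splits X" and int: "\<forall>x\<in>X. \<forall>y\<in>X. d x y \<in> \<int>"
  obtains a a' b b' where "a \<in> X" "a' \<in> X" "b \<in> X" "b' \<in> X" "separates S a a' b b'"
    "gap d a a' b b' = 2 * isolation_index d S" "gap d a a' b b' \<in> \<int>"
proof -
  have int': "z \<in> \<int>" if "z \<in> gaps X d S" for z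
    using that int by (elim gapsE) (simp add: gap_def max_def)
  obtain z0 where "z0 \<in> gaps X d S" using gaps_nonempty[OF S, of d] by blast
  then obtain z where z: "z \<in> gaps X d S"
    and min: "\<And>w. w \<in> gaps X d S \<Longrightarrow> nat \<lfloor>z\<rfloor> \<le> nat \<lfloor>w\<rfloor>"
    using ex_has_least_nat[of "\<lambda>z. z \<in> gaps X d S" z0 "\<lambda>z. nat \<lfloor>z\<rfloor>"] by blast
  have "z \<le> w" if w: "w \<in> gaps X d S" for w
  proof -
    have "\<lfloor>z\<rfloor> \<le> \<lfloor>w\<rfloor>" using min[OF w] gaps_nonneg[OF w] by (simp add: nat_le_eq_zle)
    then show ?thesis using int'[OF z] int'[OF w] by (metis Ints_cases floor_of_int of_int_le_iff)
  qed
  then have iso: "isolated_by X d S (z / 2)" unfolding isolated_by_iff_gaps by simp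
  obtain a a' b b' where m: "a \<in> X" "a' \<in> X" "b \<in> X" "b' \<in> X" "separates S a a' b b'"
    and e: "z = gap d a a' b b'" using z by (elim gapsE)
  have "isolation_index d S = z / 2"
    by (rule isolation_index_eqI[OF S iso m]) (simp add: e)
  then show thesis using that[OF m] int'[OF z] e by simp
qed

section \<open>Two splits separating the same quadruple\<close>

text \<open>Two of the four inequalities that \<open>S\<close> and \<open>T\<close> give at \<open>x\<close>, or else all four,
  add up to the claim.\<close>

lemma gap_two_splits_aux:
  assumes d: "pseudometric_on X d" and X: "a \<in> X" "a' \<in> X" "b \<in> X" "b' \<in> X" "x \<in> X"
    and uv: "0 < u" "0 < v" "isolated_by X d S u" "isolated_by X d T v"
    and S: "separates S a a' b b'" "split_part S x = split_part S a"
    and T: "separates T a a' b b'" "split_part T x = split_part T b"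
  shows "2 * u + 2 * v \<le> gap d a a' b b'"
proof -
  have sep: "separates S a x b b'" "separates S a' x b b'"
    "separates T a a' b x" "separates T a a' b' x"
    using S T by (auto simp: separates_def)
  have ineqs: "2 * u \<le> gap d a x b b'" "2 * u \<le> gap d a' x b b'"
    "2 * v \<le> gap d a a' b x" "2 * v \<le> gap d a a' b' x"
    using isolated_byD[OF uv(3)] isolated_byD[OF uv(4)] sep X by blast+
  have "d x b = d b x" "d x b' = d b' x"
    using pseudometric_onD(3)[OF d] X by auto
  note sym = this
  have pos: "0 < 2 * u" "0 < 2 * v" "0 < 2 * u + 2 * v" using uv(1,2) by simp_all
  show ?thesis
    unfolding gap_pos_iff[OF pos(3)]
    using ineqs[unfolded gap_pos_iff[OF pos(1)] gap_pos_iff[OF pos(2)]] sym by argo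
qed

text \<open>Since the splits differ but agree on the quadruple, some fifth point \<open>x\<close>
  lies with \<open>a\<close> in one and with \<open>b\<close> in the other. The two cases are
  exchanged by swapping \<open>S\<close> with \<open>T\<close> and \<open>u\<close> with
  \<open>v\<close>.\<close>

lemma gap_two_splits:
  assumes d: "pseudometric_on X d" and X: "a \<in> X" "a' \<in> X" "b \<in> X" "b' \<in> X"
    and uv: "0 < u" "0 < v" "isolated_by X d S u" "isolated_by X d T v"
    and ST: "S \<in> splits X" "T \<in> splits X" "S \<noteq> T"
    and S: "separates S a a' b b'" and T: "separates T a a' b b'"
  shows "2 * u + 2 * v \<le> gap d a a' b b'"
proof -
  have S': "split_part S a \<noteq> split_part S b" and T': "split_part T a \<noteq> split_part T b"
    using S T by (auto simp: separates_def)
  have "\<exists>x\<in>X. split_part S x = split_part S a \<longleftrightarrow> split_part T x \<noteq> split_part T a"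
  proof (rule ccontr)
    assume "\<not> ?thesis"
    then have "split_part S x = split_part S y \<longleftrightarrow> split_part T x = split_part T y"
      if "x \<in> X" "y \<in> X" for x y
      using split_part_two[OF ST(1) X(1,3) _ S'] split_part_two[OF ST(2) X(1,3) _ T'] that by metis
    then show False using split_eqI[OF ST(1,2)] ST(3) by blast
  qed
  then obtain x where x: "x \<in> X"
    and "split_part S x = split_part S a \<longleftrightarrow> split_part T x \<noteq> split_part T a" by blast
  then consider "split_part S x = split_part S a" "split_part T x = split_part T b"
    | "split_part T x = split_part T a" "split_part S x = split_part S b"
    using split_part_two[OF ST(1) X(1,3) x S'] split_part_two[OF ST(2) X(1,3) x T'] by metis
  then show ?thesis
  proof cases
    case 1
    then show ?thesis using gap_two_splits_aux[OF d X x uv S _ T] by blast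
  next
    case 2
    then show ?thesis
      using gap_two_splits_aux[OF d X x uv(2,1,4,3) T _ S] by (simp add: add.commute)
  qed
qed

section \<open>Subtracting a multiple of one split pseudometric\<close>

lemma split_delta_commute: "split_delta S x y = split_delta S y x"
  by (simp add: split_delta_def eq_commute)

lemma pseudometric_on_subtract:
  assumes d: "pseudometric_on X d" and T: "T \<in> splits X" "isolated_by X d T v" "0 < v" "l \<le> v"
  shows "pseudometric_on X (\<lambda>x y. d x y - l * split_delta T x y)"
proof -
  note D = pseudometric_onD[OF d]
  \<comment> \<open>The degenerate quadruple \<open>x\<close>, \<open>x\<close>, \<open>y\<close>,
    \<open>z\<close> turns the isolation bound into a bound on the triangle excess at
    \<open>x\<close>; the choice \<open>y = z\<close> then bounds a single distance.\<close>
  have far: "2 * v \<le> d x y + d x z - d y z"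
    if "x \<in> X" "y \<in> X" "z \<in> X" "split_part T x \<noteq> split_part T y" "split_part T y = split_part T z"
    for x y z
  proof -
    have "2 * v \<le> gap d x x y z"
      using isolated_byD[OF T(2)] that by (simp add: separates_def)
    then show ?thesis using T(3) D(2)[OF that(1)] by (simp add: gap_def max_def split: if_splits)
  qed
  have "l * split_delta T x y \<le> d x y" if "x \<in> X" "y \<in> X" for x y
    using far[of x y y] that D(1)[of x y] D(2)[of y] T(4)
    by (cases "split_part T x = split_part T y") (simp_all add: split_delta_def)
  moreover have "d x z - l * split_delta T x z
      \<le> d x y - l * split_delta T x y + (d y z - l * split_delta T y z)"
    if X: "x \<in> X" "y \<in> X" "z \<in> X" for x y z
  proof -
    have "d x z \<le> d x y + d y z" using D(4) X by blast
    \<comment> \<open>Only here do the two sides change by different amounts: \<open>y\<close> is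
      alone against \<open>x\<close> and \<open>z\<close>, so both of its distances lose
      \<open>l\<close> while \<open>d x z\<close> stays.\<close>
    moreover have "2 * l \<le> d x y + d y z - d x z"
      if "split_part T x \<noteq> split_part T y" "split_part T y \<noteq> split_part T z"
    proof -
      have "split_part T x = split_part T z" using split_part_two[OF T(1)] X that by metis
      then show ?thesis using far[of y x z] X that T(4) D(3)[of x y] by auto
    qed
    ultimately show ?thesis
      by (cases "split_part T x = split_part T y"; cases "split_part T y = split_part T z";
          cases "split_part T x = split_part T z") (simp_all add: split_delta_def)
  qed
  ultimately show ?thesis
    unfolding pseudometric_on_def
    using D(2,3) split_delta_commute[of T] by (simp add: split_delta_def)
qed

text \<open>At most two values occur. Either they divide the four entries two against two, in one of
  three ways, or at most one entry is odd; an odd entry meets exactly one pair of each pairing, so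
  all three pairings count equally many differences.\<close>

lemma quadruple_types:
  assumes "q = p \<or> r = p \<or> q = r" "q = p \<or> s = p \<or> q = s" "r = p \<or> s = p \<or> r = s"
  shows "p = q \<and> r = s \<and> p \<noteq> r \<or> p = r \<and> q = s \<and> p \<noteq> q \<or> p = s \<and> q = r \<and> p \<noteq> q \<or>
    (if p \<noteq> r then 1 else 0) + (if q \<noteq> s then 1 else 0)
      = (if p \<noteq> q then 1 else 0) + (if r \<noteq> s then 1 else 0 :: real) \<and>
    (if q \<noteq> r then 1 else 0) + (if p \<noteq> s then 1 else 0)
      = (if p \<noteq> q then 1 else 0) + (if r \<noteq> s then 1 else 0 :: real)"
  using assms by (cases "p = q"; cases "p = r"; cases "p = s") auto

lemma separates_delta:
  assumes "separates S a a' b b'"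
  shows "split_delta S a a' = 0" "split_delta S b b' = 0" "split_delta S a b = 1"
    "split_delta S a' b' = 1" "split_delta S a' b = 1" "split_delta S a b' = 1"
proof -
  have "split_part S a = split_part S a'" "split_part S b = split_part S b'"
    "split_part S a \<noteq> split_part S b"
    using assms unfolding separates_def by blast+
  then show "split_delta S a a' = 0" "split_delta S b b' = 0" "split_delta S a b = 1"
    "split_delta S a' b' = 1" "split_delta S a' b = 1" "split_delta S a b' = 1"
    by (simp_all add: split_delta_def)
qed

text \<open>If \<open>T\<close> does not divide the quadruple two against two, all three pair sums
  change by the same amount. If it does, one pair sum stays and the other two lose
  \<open>2 * l\<close>; the larger of these exceeded the fixed one by at least \<open>2 * v\<close>,
  so it is still a maximum afterwards.\<close>

lemma gap_subtract:
  assumes d: "pseudometric_on X d" and T: "T \<in> splits X" "isolated_by X d T v" "0 < v" "l \<le> v"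
    and X: "a \<in> X" "a' \<in> X" "b \<in> X" "b' \<in> X"
  shows "gap (\<lambda>x y. d x y - l * split_delta T x y) a a' b b' =
    gap d a a' b b' - (if separates T a a' b b' then 2 * l else 0)"
proof -
  have sym: "d b a = d a b" "d b' a = d a b'" "d b a' = d a' b" "d b' a' = d a' b'"
     "d b' b = d b b'" "d a' a = d a a'"
    using pseudometric_onD(3)[OF d] X by auto
  have pos: "0 < 2 * v" using T(3) by simp
  have le1: "2 * v \<le> gap d a a' b b'" if "separates T a a' b b'"
    using isolated_byD[OF T(2)] X that by blast
  have le2: "2 * v \<le> gap d a b a' b'" if "separates T a b a' b'"
    using isolated_byD[OF T(2)] X that by blast
  have le3: "2 * v \<le> gap d a b' a' b" if "separates T a b' a' b"
    using isolated_byD[OF T(2)] X that by blast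
  have two: "split_part T y = split_part T a \<or> split_part T z = split_part T a
      \<or> split_part T y = split_part T z" if "y \<in> X" "z \<in> X" for y z
    using split_part_two[OF T(1) that(1) X(1) that(2)] by metis
  note two' = two[OF X(2,3)] two[OF X(2,4)] two[OF X(3,4)]
  define e where "e x y = d x y - l * split_delta T x y" for x y
  have types: "separates T a a' b b' \<or> separates T a b a' b' \<or> separates T a b' a' b \<or>
    split_delta T a b + split_delta T a' b' = split_delta T a a' + split_delta T b b' \<and>
    split_delta T a' b + split_delta T a b' = split_delta T a a' + split_delta T b b'"
    unfolding separates_def split_delta_def by (rule quadruple_types[OF two'])
  have "gap e a a' b b' = gap d a a' b b' - (if separates T a a' b b' then 2 * l else 0)"
  proof (cases "separates T a a' b b'")
    case True
    note pos_le = le1[OF True, unfolded gap_pos_iff[OF pos]]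
    show ?thesis
      using True pos_le pos T(4) separates_delta[OF True] unfolding gap_def e_def by simp linarith
  next
    case False
    with types consider "separates T a b a' b'" | "separates T a b' a' b"
      | "split_delta T a b + split_delta T a' b' = split_delta T a a' + split_delta T b b'"
        "split_delta T a' b + split_delta T a b' = split_delta T a a' + split_delta T b b'"
      by argo
    then show ?thesis
    proof cases
      \<comment> \<open>Now \<open>d a b + d a' b'\<close> is the unchanged sum. It lies at least
        \<open>2 * v\<close> below the maximum, so the maximum and \<open>d a a' + d b b'\<close>
        both drop by \<open>2 * l\<close> and the gap stays.\<close>
      case 1
      note pos_le = le2[OF 1, unfolded gap_pos_iff[OF pos]]
      show ?thesis
        using False pos_le sym pos T(4) separates_delta[OF 1] split_delta_commute[of T b a']
        unfolding gap_def e_def by simp linarith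
    next
      case 2
      note pos_le = le3[OF 2, unfolded gap_pos_iff[OF pos]]
      show ?thesis
        using False pos_le sym pos T(4) separates_delta[OF 2]
          split_delta_commute[of T b' b] split_delta_commute[of T b' a']
          split_delta_commute[of T b a']
        unfolding gap_def e_def by simp linarith
    next
      case 3
      define k where "k = l * (split_delta T a a' + split_delta T b b')"
      have k: "l * (split_delta T a b + split_delta T a' b') = k"
        "l * (split_delta T a' b + split_delta T a b') = k"
        unfolding k_def 3 by (rule refl)+
      have "e a b + e a' b' = d a b + d a' b' - k" "e a' b + e a b' = d a' b + d a b' - k"
        "e a a' + e b b' = d a a' + d b b' - k"
        using k k_def unfolding e_def distrib_left by linarith+
      then show ?thesis using False unfolding gap_def diff_diff_eq by simp
    qed
  qed
  then show ?thesis by (simp add: e_def[abs_def])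
qed

text \<open>For \<open>S = T\<close> every gap of \<open>S\<close> drops by \<open>2 * l\<close>.
  For distinct splits only the quadruples separated by both are affected; their gap is at least
  \<open>2 * u + 2 * v\<close>, so they absorb the loss, and as \<open>v\<close> is positive, none
  of them attains \<open>2 * u\<close>.\<close>

lemma isolated_by_subtract:
  assumes d: "pseudometric_on X d" and T: "T \<in> splits X" "isolated_by X d T v" "0 < v" "l \<le> v"
    and S: "S \<in> splits X" "isolated_by X d S u" "0 \<le> u"
  defines "e \<equiv> \<lambda>x y. d x y - l * split_delta T x y"
    and "w \<equiv> u - (if S = T then l else 0)"
  shows "isolated_by X e S w"
    and "a \<in> X \<Longrightarrow> a' \<in> X \<Longrightarrow> b \<in> X \<Longrightarrow> b' \<in> X \<Longrightarrow> separates S a a' b b' \<Longrightarrow>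
      gap d a a' b b' = 2 * u \<Longrightarrow> gap e a a' b b' = 2 * w"
proof -
  have e: "gap e a a' b b' = gap d a a' b b' - (if separates T a a' b b' then 2 * l else 0)"
    if "a \<in> X" "a' \<in> X" "b \<in> X" "b' \<in> X" for a a' b b'
    unfolding e_def by (rule gap_subtract[OF d T that])
  have both: "2 * u + 2 * v \<le> gap d a a' b b'"
    if "a \<in> X" "a' \<in> X" "b \<in> X" "b' \<in> X" "separates S a a' b b'" "separates T a a' b b'" "S \<noteq> T"
    for a a' b b'
  proof (cases "u = 0")
    case True
    then show ?thesis using isolated_byD[OF T(2)] that by simp
  next
    case False
    then have "0 < u" using S(3) by simp
    then show ?thesis
      using gap_two_splits[OF d that(1-4) _ T(3) S(2) T(2) S(1) T(1) that(7,5,6)] by simp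
  qed
  show "isolated_by X e S w"
    unfolding isolated_by_def
  proof (intro ballI impI)
    fix a a' b b' assume q: "a \<in> X" "a' \<in> X" "b \<in> X" "b' \<in> X" and sep: "separates S a a' b b'"
    have "2 * u \<le> gap d a a' b b'" by (rule isolated_byD[OF S(2) q sep])
    moreover have "2 * u + 2 * l \<le> gap d a a' b b'" if "separates T a a' b b'" "S \<noteq> T"
      using both[OF q sep that] T(4) by simp
    ultimately show "2 * w \<le> gap e a a' b b'"
      using sep unfolding e[OF q] w_def
      by (cases "S = T"; cases "separates T a a' b b'") simp_all
  qed
  assume q: "a \<in> X" "a' \<in> X" "b \<in> X" "b' \<in> X" and sep: "separates S a a' b b'"
    and min: "gap d a a' b b' = 2 * u"
  have "\<not> separates T a a' b b'" if "S \<noteq> T" using both[OF q sep _ that] min T(3) by auto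
  then show "gap e a a' b b' = 2 * w"
    using sep min unfolding e[OF q] w_def by (cases "S = T") simp_all
qed

section \<open>Subtracting finitely many d-splits\<close>

lemma subtract_finite:
  assumes d: "pseudometric_on X d" and "finite F" "F \<subseteq> d_splits X d"
    and lam: "\<forall>S\<in>d_splits X d. lam S \<le> isolation_index d S"
  defines "e \<equiv> \<lambda>F x y. d x y - (\<Sum>S\<in>F. lam S * split_delta S x y)"
    and "w \<equiv> \<lambda>F S. isolation_index d S - (if S \<in> F then lam S else 0)"
  shows "pseudometric_on X (e F)"
    and "S \<in> splits X \<Longrightarrow> isolated_by X (e F) S (w F S)"
    and "S \<in> splits X \<Longrightarrow> a \<in> X \<Longrightarrow> a' \<in> X \<Longrightarrow> b \<in> X \<Longrightarrow> b' \<in> X \<Longrightarrow> separates S a a' b b' \<Longrightarrow>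
      gap d a a' b b' = 2 * isolation_index d S \<Longrightarrow> gap (e F) a a' b b' = 2 * w F S"
proof -
  \<comment> \<open>The minimising quadruples of \<open>d\<close> are carried through the induction:
    real coefficients can destroy integrality, so minima for \<open>e F\<close> could not be
    obtained from it afresh.\<close>
  have "pseudometric_on X (e F) \<and> (\<forall>S\<in>splits X. isolated_by X (e F) S (w F S) \<and>
    (\<forall>a\<in>X. \<forall>a'\<in>X. \<forall>b\<in>X. \<forall>b'\<in>X. separates S a a' b b' \<longrightarrow>
      gap d a a' b b' = 2 * isolation_index d S \<longrightarrow> gap (e F) a a' b b' = 2 * w F S))"
    using assms(2,3)
  proof (induction F rule: finite_induct)
    case empty
    then show ?case
      using d isolated_by_isolation_index[of _ X d] by (simp add: e_def w_def)
  next
    case (insert T F)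
    then have pm: "pseudometric_on X (e F)"
      and iso: "\<And>S. S \<in> splits X \<Longrightarrow> isolated_by X (e F) S (w F S)"
      and att: "\<And>S a a' b b'. S \<in> splits X \<Longrightarrow> a \<in> X \<Longrightarrow> a' \<in> X \<Longrightarrow> b \<in> X \<Longrightarrow> b' \<in> X \<Longrightarrow>
        separates S a a' b b' \<Longrightarrow> gap d a a' b b' = 2 * isolation_index d S \<Longrightarrow>
        gap (e F) a a' b b' = 2 * w F S"
      by blast+
    \<comment> \<open>As \<open>T\<close> is not in \<open>F\<close>, its bound is still its full
      isolation index in \<open>d\<close>, which is positive and at least \<open>lam T\<close>; so
      the step for one split applies.\<close>
    have T: "T \<in> splits X" "0 < w F T" "lam T \<le> w F T"
      using insert.hyps insert.prems lam by (auto simp: d_splits_def w_def)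
    have e: "e (insert T F) = (\<lambda>x y. e F x y - lam T * split_delta T x y)"
      using insert.hyps by (auto simp: e_def fun_eq_iff)
    have w: "w (insert T F) S = w F S - (if S = T then lam T else 0)" for S
      using insert.hyps by (auto simp: w_def)
    have nonneg: "0 \<le> w F S" if "S \<in> splits X" for S
      using isolation_index_nonneg[OF that, of d] lam insert.prems by (auto simp: w_def)
    note step = isolated_by_subtract[OF pm T(1) iso[OF T(1)] T(2,3)]
    have "pseudometric_on X (e (insert T F))"
      unfolding e by (rule pseudometric_on_subtract[OF pm T(1) iso[OF T(1)] T(2,3)])
    moreover have "isolated_by X (e (insert T F)) S (w (insert T F) S)" if "S \<in> splits X" for S
      unfolding e w by (rule step(1)[OF that iso[OF that] nonneg[OF that]])
    moreover have "gap (e (insert T F)) a a' b b' = 2 * w (insert T F) S"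
      if S: "S \<in> splits X" and q: "a \<in> X" "a' \<in> X" "b \<in> X" "b' \<in> X" "separates S a a' b b'"
        and min: "gap d a a' b b' = 2 * isolation_index d S" for S a a' b b'
      unfolding e w by (rule step(2)[OF S iso[OF S] nonneg[OF S] q att[OF S q min]])
    ultimately show ?case by blast
  qed
  then show "pseudometric_on X (e F)"
    and "S \<in> splits X \<Longrightarrow> isolated_by X (e F) S (w F S)"
    and "S \<in> splits X \<Longrightarrow> a \<in> X \<Longrightarrow> a' \<in> X \<Longrightarrow> b \<in> X \<Longrightarrow> b' \<in> X \<Longrightarrow> separates S a a' b b' \<Longrightarrow>
      gap d a a' b b' = 2 * isolation_index d S \<Longrightarrow> gap (e F) a a' b b' = 2 * w F S"
    by blast+
qed

section \<open>Finiteness of the d-splits separating two points\<close>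

lemma finite_separating_d_splits:
  assumes d: "pseudometric_on X d" and int: "\<forall>x\<in>X. \<forall>y\<in>X. d x y \<in> \<int>" and X: "x \<in> X" "y \<in> X"
  shows "finite {S \<in> d_splits X d. split_delta S x y \<noteq> 0}"
proof -
  have half: "1 / 2 \<le> isolation_index d S" if S: "S \<in> d_splits X d" for S
  proof -
    have S': "S \<in> splits X" "0 < isolation_index d S" using S unfolding d_splits_def by simp_all
    have "2 * isolation_index d S \<in> \<int>"
      by (rule isolation_index_attained[OF S'(1) int]) simp
    then show ?thesis
      using S'(2) Ints_nonzero_abs_ge1[of "2 * isolation_index d S"] by simp
  qed
  have "card F \<le> nat \<lceil>2 * d x y\<rceil>"
    if F: "F \<subseteq> {S \<in> d_splits X d. split_delta S x y \<noteq> 0}" "finite F" for F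
  proof -
    \<comment> \<open>Removing the splits of \<open>F\<close> with their full indices leaves a
      nonnegative distance of \<open>x\<close> and \<open>y\<close>, so these indices, each at least
      1/2, sum to at most \<open>d x y\<close>.\<close>
    have "pseudometric_on X (\<lambda>x y. d x y - (\<Sum>S\<in>F. isolation_index d S * split_delta S x y))"
      using F by (intro subtract_finite(1)[OF d]) auto
    from pseudometric_onD(1)[OF this X]
    have "(\<Sum>S\<in>F. isolation_index d S * split_delta S x y) \<le> d x y" by simp
    moreover have "(\<Sum>S\<in>F. 1 / 2) \<le> (\<Sum>S\<in>F. isolation_index d S * split_delta S x y)"
    proof (rule sum_mono)
      fix S assume "S \<in> F"
      then have "S \<in> d_splits X d" "split_delta S x y = 1"
        using F(1) by (auto simp: split_delta_def)
      then show "1 / 2 \<le> isolation_index d S * split_delta S x y" using half by simp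
    qed
    ultimately have "real (card F) \<le> 2 * d x y" by simp
    then show ?thesis by linarith
  qed
  then show ?thesis by (intro conjunct1[OF finite_if_finite_subsets_card_bdd])
qed

section \<open>Passage to the infinite sum\<close>

lemma subtract_d_splits:
  assumes d: "pseudometric_on X d" and int: "\<forall>x\<in>X. \<forall>y\<in>X. d x y \<in> \<int>"
    and lam: "\<forall>S\<in>d_splits X d. lam S \<le> isolation_index d S"
    and lam0: "\<forall>S\<in>splits X - d_splits X d. lam S = 0"
  defines "dt \<equiv> \<lambda>x y. d x y - (\<Sum>\<^sub>\<infinity>S\<in>d_splits X d. lam S * split_delta S x y)"
  shows "pseudometric_on X dt"
    and "S \<in> splits X \<Longrightarrow> isolation_index dt S = isolation_index d S - lam S"
proof -
  define e where "e F = (\<lambda>x y. d x y - (\<Sum>S\<in>F. lam S * split_delta S x y))" for F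
  \<comment> \<open>On finitely many points \<open>dt\<close> is a finite subtraction, since only
    the d-splits separating two of them contribute. Including \<open>S\<close> whenever it is a
    d-split makes the finite case yield \<open>isolation_index d S - lam S\<close> for each such
    \<open>F\<close>.\<close>
  have local: "\<exists>F. finite F \<and> F \<subseteq> d_splits X d \<and> {S} \<inter> d_splits X d \<subseteq> F \<and>
      (\<forall>x\<in>Y. \<forall>y\<in>Y. dt x y = e F x y)"
    if Y: "finite Y" "Y \<subseteq> X" for Y
  proof -
    define F where "F = ({S} \<inter> d_splits X d) \<union> (\<Union>x\<in>Y. \<Union>y\<in>Y. {S \<in> d_splits X d. split_delta S x y \<noteq> 0})"
    have "finite F"
      unfolding F_def using Y by (auto intro!: finite_separating_d_splits[OF d int])
    moreover have sub: "F \<subseteq> d_splits X d" "{S} \<inter> d_splits X d \<subseteq> F" by (auto simp: F_def)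
    moreover have "dt x y = e F x y" if "x \<in> Y" "y \<in> Y" for x y
    proof -
      have "(\<Sum>\<^sub>\<infinity>S\<in>d_splits X d. lam S * split_delta S x y)
          = (\<Sum>\<^sub>\<infinity>S\<in>F. lam S * split_delta S x y)"
        by (rule infsum_cong_neutral) (use sub that in \<open>auto simp: F_def\<close>)
      then show ?thesis using \<open>finite F\<close> by (simp add: dt_def e_def)
    qed
    ultimately show ?thesis by (intro exI[of _ F]) simp
  qed
  note fin = subtract_finite[OF d _ _ lam, folded e_def]
  have tri: "0 \<le> dt x y \<and> dt x x = 0 \<and> dt x y = dt y x \<and> dt x z \<le> dt x y + dt y z"
    if X: "x \<in> X" "y \<in> X" "z \<in> X" for x y z
  proof -
    have fin_Y: "finite {x, y, z}" "{x, y, z} \<subseteq> X" using X by simp_all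
    obtain F where F: "finite F" "F \<subseteq> d_splits X d" and "{S} \<inter> d_splits X d \<subseteq> F"
      and eq: "\<forall>u\<in>{x, y, z}. \<forall>v\<in>{x, y, z}. dt u v = e F u v"
      using local[OF fin_Y] by (elim exE conjE)
    note D = pseudometric_onD[OF fin(1)[OF F]]
    have "0 \<le> e F x y" "e F x x = 0" "e F x y = e F y x" "e F x z \<le> e F x y + e F y z"
      by (rule D(1)[OF X(1,2)] D(2)[OF X(1)] D(3)[OF X(1,2)] D(4)[OF X])+
    then show ?thesis using eq by simp
  qed
  then show "pseudometric_on X dt" unfolding pseudometric_on_def by blast
  assume S: "S \<in> splits X"
  have gap_e: "\<exists>F. finite F \<and> F \<subseteq> d_splits X d \<and> gap dt a a' b b' = gap (e F) a a' b b' \<and>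
      (if S \<in> F then lam S else 0) = lam S"
    if X: "a \<in> X" "a' \<in> X" "b \<in> X" "b' \<in> X" for a a' b b'
  proof -
    have fin_Y: "finite {a, a', b, b'}" "{a, a', b, b'} \<subseteq> X" using X by simp_all
    obtain F where F: "finite F" "F \<subseteq> d_splits X d" "{S} \<inter> d_splits X d \<subseteq> F"
      and eq: "\<forall>u\<in>{a, a', b, b'}. \<forall>v\<in>{a, a', b, b'}. dt u v = e F u v"
      using local[OF fin_Y] by (elim exE conjE)
    have "gap dt a a' b b' = gap (e F) a a' b b'" by (rule gap_cong) (use eq in blast)
    \<comment> \<open>A d-split \<open>S\<close> belongs to \<open>F\<close>; for any other split
      \<open>lam S\<close> is zero.\<close>
    moreover have "(if S \<in> F then lam S else 0) = lam S" using F(3) S lam0 by auto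
    ultimately show ?thesis using F(1,2) by (intro exI[of _ F]) simp
  qed
  have iso: "isolated_by X dt S (isolation_index d S - lam S)"
    unfolding isolated_by_def
  proof (intro ballI impI)
    fix a a' b b' assume q: "a \<in> X" "a' \<in> X" "b \<in> X" "b' \<in> X" and sep: "separates S a a' b b'"
    obtain F where F: "finite F" "F \<subseteq> d_splits X d" "gap dt a a' b b' = gap (e F) a a' b b'"
      "(if S \<in> F then lam S else 0) = lam S" using gap_e[OF q] by (elim exE conjE)
    show "2 * (isolation_index d S - lam S) \<le> gap dt a a' b b'"
      using isolated_byD[OF fin(2)[OF F(1,2) S] q sep] unfolding F(3,4) .
  qed
  \<comment> \<open>Integrality of \<open>d\<close> provides a minimising quadruple; its gap under
    \<open>dt\<close> meets the lower bound in \<open>iso\<close>.\<close>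
  obtain a a' b b' where q: "a \<in> X" "a' \<in> X" "b \<in> X" "b' \<in> X" and sep: "separates S a a' b b'"
    and min: "gap d a a' b b' = 2 * isolation_index d S"
    by (rule isolation_index_attained[OF S int])
  obtain F where F: "finite F" "F \<subseteq> d_splits X d" "gap dt a a' b b' = gap (e F) a a' b b'"
    "(if S \<in> F then lam S else 0) = lam S" using gap_e[OF q] by (elim exE conjE)
  show "isolation_index dt S = isolation_index d S - lam S"
    using fin(3)[OF F(1,2) S q sep min] unfolding F(3)[symmetric] F(4)
    by (rule isolation_index_eqI[OF S iso q sep])
qed

theorem theorem1p3:
  fixes X :: "'a set" and d :: "'a \<Rightarrow> 'a \<Rightarrow> real"
  assumes "pseudometric_on X d"
    and "\<forall>x\<in>X. \<forall>y\<in>X. d x y \<in> \<int>"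
  shows "(\<forall>x\<in>X. \<forall>y\<in>X. finite {S \<in> d_splits X d. split_delta S x y \<noteq> 0}) \<and>
    (\<forall>lam :: 'a set set \<Rightarrow> real.
       (\<forall>S\<in>d_splits X d. lam S \<le> isolation_index d S) \<longrightarrow>
       (\<forall>S\<in>splits X - d_splits X d. lam S = 0) \<longrightarrow>
       (let dt = (\<lambda>x y. d x y - (\<Sum>\<^sub>\<infinity>S\<in>d_splits X d. lam S * split_delta S x y))
        in pseudometric_on X dt \<and>
           (\<forall>S\<in>splits X. isolation_index dt S = isolation_index d S - lam S))) \<and>
    (\<exists>d0. pseudometric_on X d0 \<and> split_prime X d0 \<and>
       (\<forall>x\<in>X. \<forall>y\<in>X.
          d x y = d0 x y + (\<Sum>\<^sub>\<infinity>S\<in>splits X. isolation_index d S * split_delta S x y)))"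
proof (intro conjI allI impI ballI)
  fix x y assume "x \<in> X" "y \<in> X"
  then show "finite {S \<in> d_splits X d. split_delta S x y \<noteq> 0}"
    by (rule finite_separating_d_splits[OF assms])
next
  fix lam :: "'a set set \<Rightarrow> real"
  assume lam: "\<forall>S\<in>d_splits X d. lam S \<le> isolation_index d S"
    "\<forall>S\<in>splits X - d_splits X d. lam S = 0"
  show "let dt = (\<lambda>x y. d x y - (\<Sum>\<^sub>\<infinity>S\<in>d_splits X d. lam S * split_delta S x y))
    in pseudometric_on X dt \<and>
      (\<forall>S\<in>splits X. isolation_index dt S = isolation_index d S - lam S)"
    unfolding Let_def by (intro conjI ballI subtract_d_splits[OF assms lam])
next
  define d0 where "d0 = (\<lambda>x y.
    d x y - (\<Sum>\<^sub>\<infinity>S\<in>d_splits X d. isolation_index d S * split_delta S x y))"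
  \<comment> \<open>This serves twice: it makes the indices themselves admissible coefficients, and
    it extends the sum from the d-splits to all splits.\<close>
  have zero: "isolation_index d S = 0" if "S \<in> splits X - d_splits X d" for S
  proof -
    have "0 \<le> isolation_index d S" "\<not> 0 < isolation_index d S"
      using that isolation_index_nonneg by (auto simp: d_splits_def)
    then show ?thesis by simp
  qed
  have lam: "\<forall>S\<in>d_splits X d. isolation_index d S \<le> isolation_index d S"
    "\<forall>S\<in>splits X - d_splits X d. isolation_index d S = 0"
    using zero by blast+
  note d0 = subtract_d_splits[OF assms lam, folded d0_def]
  have prime: "split_prime X d0" unfolding split_prime_def using d0(2) by simp
  have "(\<Sum>\<^sub>\<infinity>S\<in>splits X. isolation_index d S * split_delta S x y)
      = (\<Sum>\<^sub>\<infinity>S\<in>d_splits X d. isolation_index d S * split_delta S x y)" for x y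
  proof (rule infsum_cong_neutral)
    fix S assume "S \<in> d_splits X d - splits X"
    then show "isolation_index d S * split_delta S x y = 0" unfolding d_splits_def by blast
  qed (simp_all only: zero mult_zero_left)
  then have sum: "\<forall>x\<in>X. \<forall>y\<in>X.
      d x y = d0 x y + (\<Sum>\<^sub>\<infinity>S\<in>splits X. isolation_index d S * split_delta S x y)"
    by (simp add: d0_def)
  show "\<exists>d0. pseudometric_on X d0 \<and> split_prime X d0 \<and>
    (\<forall>x\<in>X. \<forall>y\<in>X.
      d x y = d0 x y + (\<Sum>\<^sub>\<infinity>S\<in>splits X. isolation_index d S * split_delta S x y))"
    using d0(1) prime sum by (intro exI[of _ d0] conjI)
qed

end
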